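(* The power series $F_k(q)=\sum_{j\geq 0}q^{kj}(q;q)_j$ satisfy the following. (i) $F_1(q)$ is of Bloch--Pólya type. (ii) $F_2(q)$ is of Bloch--Pólya type. (iii) $F_3(q)-q^9$ and $F_4(q)-q^{16}+q^{18}+q^{30}-q^{31}$ are both of Bloch--Pólya type. (iv) $F_5(q)$ is not of Bloch--Pólya type, and there is no polynomial $f(q)$ such that $F_5(q)+f(q)$ is of Bloch--Pólya type. (v) $F_6(q)-f_6(q)$ is of Bloch--Pólya type, where $$\begin{aligned}f_6(q)=\;&q^{29}-q^{32}+q^{36}-q^{38}+q^{43}-q^{45}+q^{50}-q^{56}+q^{57}+q^{58}-q^{62}-q^{63}+q^{64}\\&+q^{71}-q^{80}-q^{81}+q^{84}+q^{85}+q^{106}-q^{110}-q^{239}+q^{241}+q^{280}-q^{281}.\end{aligned}$$ (vi) For every integer $k\geq 7$, there is no polynomial $f(q)$ such that $F_k(q)+f(q)$ is of Bloch--Pólya type.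
   Context: A polynomial (or power series) in $q$ is said to be of Bloch--Pólya type if all of its coefficients belong to the set $\{-1,0,1\}$. For a non-negative integer $j$, $(q;q)_j=\prod_{i=1}^{j}(1-q^i)$, with $(q;q)_0=1$. For a positive integer $k$, $F_k(q)=\sum_{j\geq 0}q^{kj}(q;q)_j$, regarded as a power series in $q$ (it converges for $|q|<1$, and as a formal power series). *)

theory Defs
  imports Complex_Main "HOL-Computational_Algebra.Polynomial_FPS"
begin

definition bloch_polya :: "'a::comm_ring_1 fps \<Rightarrow> bool" where
  "bloch_polya f \<longleftrightarrow> (\<forall>n. fps_nth f n \<in> {- 1, 0, 1})"

definition qpoch :: "nat \<Rightarrow> 'a::comm_ring_1 fps" where
  "qpoch j = (\<Prod>i=1..j. 1 - fps_X ^ i)"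

text \<open>The infinite sum is taken in the usual (coefficientwise) topology on formal power series.
  It converges for \<open>k \<ge> 1\<close>, see \<open>F_series_sums\<close>; the value at \<open>k = 0\<close> has no meaning.\<close>

definition F_series :: "nat \<Rightarrow> 'a::comm_ring_1 fps" where
  "F_series k = (\<Sum>j. fps_X ^ (k * j) * qpoch j)"

definition f6 :: "'a::comm_ring_1 fps" where
  "f6 = fps_X ^ 29 - fps_X ^ 32 + fps_X ^ 36 - fps_X ^ 38 + fps_X ^ 43 - fps_X ^ 45
      + fps_X ^ 50 - fps_X ^ 56 + fps_X ^ 57 + fps_X ^ 58 - fps_X ^ 62 - fps_X ^ 63 + fps_X ^ 64
      + fps_X ^ 71 - fps_X ^ 80 - fps_X ^ 81 + fps_X ^ 84 + fps_X ^ 85 + fps_X ^ 106 - fps_X ^ 110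
      - fps_X ^ 239 + fps_X ^ 241 + fps_X ^ 280 - fps_X ^ 281"

lemma F_series_sums_aux:
  assumes "k \<ge> 1"
  shows "(\<lambda>j. fps_X ^ (k * j) * qpoch j) sums
    Abs_fps (\<lambda>n. \<Sum>j\<le>n. fps_nth (fps_X ^ (k * j) * qpoch j :: 'a::comm_ring_1 fps) n)"
  unfolding sums_def
proof (rule tendsto_fpsI)
  fix n
  let ?t = "\<lambda>j. fps_X ^ (k * j) * qpoch j :: 'a fps"
  have "fps_nth (\<Sum>j<m. ?t j) n = (\<Sum>j\<le>n. fps_nth (?t j) n)" if "m > n" for m
    unfolding fps_sum_nth
  proof (rule sum.mono_neutral_right)
    show "\<forall>j\<in>{..<m} - {..n}. fps_nth (?t j) n = 0"
    proof
      fix j assume "j \<in> {..<m} - {..n}"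
      then have "n < j" by simp
      also have "j \<le> k * j" using assms by simp
      finally show "fps_nth (?t j) n = 0" by (simp add: fps_X_power_mult_nth)
    qed
  qed (use that in auto)
  then show "\<forall>\<^sub>F m in sequentially. fps_nth (\<Sum>j<m. ?t j) n =
      fps_nth (Abs_fps (\<lambda>n. \<Sum>j\<le>n. fps_nth (?t j) n)) n"
    by (intro eventually_mono[OF eventually_gt_at_top[of n]]) simp
qed

lemma F_series_sums:
  assumes "k \<ge> 1"
  shows "(\<lambda>j. fps_X ^ (k * j) * qpoch j) sums (F_series k :: 'a::comm_ring_1 fps)"
  unfolding F_series_def using F_series_sums_aux[OF assms] by (rule summable_sums[OF sums_summable])

lemma fps_nth_F_series:
  assumes "k \<ge> 1"
  shows "fps_nth (F_series k :: 'a::comm_ring_1 fps) n = (\<Sum>j\<le>n. fps_nth (fps_X ^ (k * j) * qpoch j) n)"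
  unfolding F_series_def sums_unique[OF F_series_sums_aux[OF assms], symmetric] by simp

end

theory Submission
  imports Defs
begin

text \<open>The recurrence \<open>q^(k+1) F_(k+1) = 1 - (1 - q^k) F_k\<close> together with \<open>q F_1 = 1 - (q;q)_\<infinity>\<close> shows
  that, up to sign, the \<open>n\<close>-th coefficient of \<open>F_k\<close> is the coefficient of index \<open>n + k(k+1)/2\<close> of
  \<open>(q;q)_(k-1) (q;q)_\<infinity>\<close>. By Euler's pentagonal number theorem (obtained here from Shanks' finite
  identity) the second factor has coefficients \<open>\<plusminus>1\<close> at the generalised pentagonal numbers, whose gaps tend
  to infinity, so far out one sees isolated copies of \<open>\<plusminus>(q;q)_(k-1)\<close>. Hence the positive statements
  amount to a finite computation, and the negative ones to a coefficient of \<open>(q;q)_(k-1)\<close> of absolute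
  value at least 2. For \<open>k = 5\<close> this is the coefficient of \<open>q^5\<close>. For \<open>k \<ge> 7\<close> one multiplies
  \<open>(q;q)_\<infinity>\<close> by \<open>1 / (q^k;q)_\<infinity> = 1 + q^k/(1-q) + q^(2k)/((1-q)(1-q^2)) + O(q^(3k))\<close>. The three summands
  contribute to the coefficient of index \<open>2k + r\<close>, \<open>r < k\<close>: the first two at most 1 each in absolute
  value, while the third is independent of \<open>k\<close> and equals 4 at \<open>r = 69\<close>. The remaining \<open>k < 70\<close> are a
  finite computation.\<close>

section \<open>Euler's pentagonal number theorem\<close>

text \<open>The closed form is \<open>s(3s-1)/2\<close>; the other generalised pentagonal number \<open>s(3s+1)/2\<close> with the
  same sign is \<open>pentagonal s + s\<close>. Every index is uniquely \<open>pentagonal s + d\<close> with \<open>d \<le> 3 s\<close>.\<close>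

fun pentagonal :: "nat \<Rightarrow> nat" where
  "pentagonal 0 = 0"
| "pentagonal (Suc s) = pentagonal s + 3 * s + 1"

definition euler :: "int fps" where
  "euler = Abs_fps (\<lambda>n. fps_nth (qpoch n) n)"

lemma qpoch_0 [simp]: "qpoch 0 = 1"
  by (simp add: qpoch_def)

lemma qpoch_Suc: "qpoch (Suc m) = qpoch m * (1 - fps_X ^ Suc m)"
  by (simp add: qpoch_def)

lemma nth_mult_one_minus_X_power:
  "fps_nth (f * (1 - fps_X ^ i)) n = fps_nth f n - (if n < i then 0 else fps_nth f (n - i))"
  for f :: "'a::comm_ring_1 fps"
  by (simp add: right_diff_distrib fps_X_power_mult_right_nth)

lemma qpoch_nth_stable: "n \<le> m \<Longrightarrow> fps_nth (qpoch m :: int fps) n = fps_nth euler n"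
proof (induction m)
  case (Suc m)
  show ?case
  proof (cases "n \<le> m")
    case True
    with Suc.IH show ?thesis by (simp add: qpoch_Suc nth_mult_one_minus_X_power del: power_Suc)
  next
    case False
    with Suc.prems have "n = Suc m" by simp
    then show ?thesis by (simp add: euler_def)
  qed
qed (simp add: euler_def)

lemma qpoch_nth_beyond_degree:
  "m * (m + 1) div 2 < n \<Longrightarrow> fps_nth (qpoch m :: int fps) n = 0"
proof (induction m arbitrary: n)
  case (Suc m)
  have "Suc m * (Suc m + 1) div 2 = m * (m + 1) div 2 + Suc m" by simp
  with Suc.prems have "m * (m + 1) div 2 < n - Suc m" by linarith
  with Suc.IH show ?case by (simp add: qpoch_Suc nth_mult_one_minus_X_power del: power_Suc)
qed simp

lemma qpoch_nth_degree: "fps_nth (qpoch m :: int fps) n \<noteq> 0 \<Longrightarrow> n \<le> m * (m + 1) div 2"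
  by (meson not_less qpoch_nth_beyond_degree)

text \<open>For \<open>s \<le> n\<close> this is the quotient (q;q)_n / (q;q)_s, written without
  division.\<close>

definition shanks_tail :: "nat \<Rightarrow> nat \<Rightarrow> int fps" where
  "shanks_tail s n = (\<Prod>i=Suc s..n. 1 - fps_X ^ i)"

text \<open>Passing from \<open>n\<close> to \<open>Suc n\<close> changes the old summand
  \<open>s\<close> by \<open>V s - U s\<close>. As \<open>V s = U (Suc s)\<close> for
  \<open>s < n\<close> and \<open>U 0 = 0\<close>, these changes telescope to \<open>V n\<close>,
  which together with the new summand gives the two new pentagonal powers.\<close>

lemma shanks:
  "(\<Sum>s\<le>n. (- 1) ^ s * fps_X ^ (s * n + s * (s + 1) div 2) * shanks_tail s n)
    = (\<Sum>s\<le>n. (- 1) ^ s * (fps_X ^ pentagonal s + (if s = 0 then 0 else fps_X ^ (pentagonal s + s))))"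
proof (induction n)
  case (Suc n)
  define tri where "tri s = s * (s + 1) div 2" for s :: nat
  have tri_0: "tri 0 = 0" and tri_Suc: "tri (Suc s) = tri s + Suc s" for s
    by (simp_all add: tri_def)
  define U :: "nat \<Rightarrow> int fps"
    where "U s = (- 1) ^ s * fps_X ^ (s * n + tri s) * (1 - fps_X ^ s) * shanks_tail s n" for s
  define V :: "nat \<Rightarrow> int fps"
    where "V s = (- 1) ^ Suc s * fps_X ^ (Suc s * Suc n + tri s) * shanks_tail s n" for s
  define T :: "nat \<Rightarrow> nat \<Rightarrow> int fps"
    where "T s n = (- 1) ^ s * fps_X ^ (s * n + tri s) * shanks_tail s n" for s n
  have V_U: "V s = U (Suc s)" if "s < n" for s
  proof -
    have "shanks_tail s n = (1 - fps_X ^ Suc s) * shanks_tail (Suc s) n"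
      using that unfolding shanks_tail_def by (intro prod.atLeast_Suc_atMost) simp
    moreover have "Suc s * Suc n + tri s = Suc s * n + tri (Suc s)" by (simp add: tri_Suc)
    ultimately show ?thesis unfolding U_def V_def by (simp only: mult_ac)
  qed
  have step: "T s (Suc n) = T s n - U s + V s" if "s \<le> n" for s
  proof -
    have tail: "shanks_tail s (Suc n) = shanks_tail s n * (1 - fps_X ^ Suc n)"
      using that unfolding shanks_tail_def by simp
    have e: "s * Suc n + tri s = (s * n + tri s) + s"
      "Suc s * Suc n + tri s = (s * n + tri s) + s + Suc n" by simp_all
    show ?thesis unfolding T_def U_def V_def tail e power_add power_Suc by algebra
  qed
  have square: "m * m + tri m = pentagonal m + m" for m
    by (induction m) (simp_all add: tri_0 tri_Suc)
  have "(\<Sum>s\<le>n. V s - U s) = V n - U n + (\<Sum>s<n. U (Suc s) - U s)"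
    using V_U by (simp add: lessThan_Suc_atMost[symmetric])
  also have "\<dots> = V n - U 0" by (simp add: sum_lessThan_telescope)
  also have "U 0 = 0" by (simp add: U_def)
  finally have telescoped: "(\<Sum>s\<le>n. V s - U s) = V n" by simp
  have "(\<Sum>s\<le>Suc n. T s (Suc n)) = (\<Sum>s\<le>n. T s n + (V s - U s)) + T (Suc n) (Suc n)"
    by (simp add: step algebra_simps)
  also have "\<dots> = (\<Sum>s\<le>n. T s n) + V n + T (Suc n) (Suc n)"
    by (simp only: sum.distrib telescoped)
  also have "T (Suc n) (Suc n) = (- 1) ^ Suc n * fps_X ^ (pentagonal (Suc n) + Suc n)"
    unfolding T_def square by (simp add: shanks_tail_def)
  also have "V n = (- 1) ^ Suc n * fps_X ^ pentagonal (Suc n)"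
  proof -
    have "Suc n * Suc n + tri n = pentagonal (Suc n)"
      using square[of "Suc n"] by (simp only: tri_Suc)
    then show ?thesis by (simp add: V_def shanks_tail_def)
  qed
  finally show ?case using Suc.IH by (simp add: T_def tri_def algebra_simps)
qed (simp add: shanks_tail_def)

section \<open>Coefficients of (q;q)_\<infinity> and gaps between its exponents\<close>

lemma pentagonal_strict_mono: "s < t \<Longrightarrow> pentagonal s + 3 * s < pentagonal t"
proof (induction t)
  case (Suc t)
  then show ?case by (cases "s = t") auto
qed simp

lemma pentagonal_ge: "s \<le> pentagonal s"
  by (induction s) auto

lemma pentagonal_blocks:
  obtains s d where "n = pentagonal s + d" "d \<le> 3 * s"
proof (induction n arbitrary: thesis)
  case 0
  show ?case by (rule 0[of 0 0]) simp_all
next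
  case (Suc n)
  obtain s d where n: "n = pentagonal s + d" "d \<le> 3 * s" by (rule Suc.IH)
  show ?case
  proof (cases "d = 3 * s")
    case True
    then show ?thesis using n by (intro Suc.prems[of "Suc s" 0]) auto
  next
    case False
    then show ?thesis using n by (intro Suc.prems[of s "Suc d"]) auto
  qed
qed

lemma pentagonal_block_unique:
  assumes "pentagonal s + d = pentagonal t + d'" "d \<le> 3 * s" "d' \<le> 3 * t"
  shows "s = t" "d = d'"
proof -
  show "s = t"
    using pentagonal_strict_mono[of s t] pentagonal_strict_mono[of t s] assms
    by (cases s t rule: linorder_cases) auto
  with assms show "d = d'" by simp
qed

text \<open>Shanks' identity is used with \<open>n\<close> equal to the index itself: on the left,
  the summands with \<open>t \<ge> 1\<close> start beyond q^n, so only the summand (q;q)_n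
  contributes.\<close>

lemma euler_nth:
  assumes "d \<le> 3 * s"
  shows "fps_nth euler (pentagonal s + d) = (if d = 0 \<or> d = s then (- 1) ^ s else 0)"
proof -
  define n where "n = pentagonal s + d"
  have "s \<le> n" using pentagonal_ge[of s] by (simp add: n_def)
  have "(\<Sum>t\<le>n. (- 1) ^ t * fps_X ^ (t * n + t * (t + 1) div 2) * shanks_tail t n)
      = qpoch n + (\<Sum>t\<in>{1..n}. (- 1) ^ t * fps_X ^ (t * n + t * (t + 1) div 2) * shanks_tail t n)"
    by (simp add: atMost_atLeast0 sum.atLeast_Suc_atMost shanks_tail_def qpoch_def)
  also have "fps_nth \<dots> n = fps_nth (qpoch n) n"
  proof -
    have "fps_nth ((- 1) ^ t * fps_X ^ (t * n + t * (t + 1) div 2) * shanks_tail t n) n = 0"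
      if t_range: "t \<in> {1..n}" for t
    proof -
      obtain u where t: "t = Suc u" using t_range by (cases t) auto
      have "n < t * n + t * (t + 1) div 2" unfolding t by simp
      then have "fps_nth (fps_X ^ (t * n + t * (t + 1) div 2) * ((- 1) ^ t * shanks_tail t n)) n = 0"
        by (simp only: fps_X_power_mult_nth if_True)
      then show ?thesis by (simp only: mult_ac)
    qed
    then show ?thesis by (simp only: fps_add_nth fps_sum_nth sum.neutral ball_simps) simp
  qed
  finally have "fps_nth (qpoch n :: int fps) n = fps_nth (\<Sum>t\<le>n. (- 1) ^ t *
      (fps_X ^ pentagonal t + (if t = 0 then 0 else fps_X ^ (pentagonal t + t)))) n"
    unfolding shanks by (rule sym)
  then have "fps_nth euler n = (\<Sum>t\<le>n. fps_nth ((- 1) ^ t *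
      (fps_X ^ pentagonal t + (if t = 0 then 0 else fps_X ^ (pentagonal t + t)))) n)"
    by (simp add: euler_def fps_sum_nth)
  also have "\<dots> = (\<Sum>t\<le>n. if t = s then (if d = 0 \<or> d = s then (- 1) ^ s else 0) else 0)"
  proof (rule sum.cong)
    fix t
    have sign: "fps_nth ((- 1) ^ t * f) n = (- 1) ^ t * fps_nth f n" for f :: "int fps"
      by (cases "even t") simp_all
    have "n = pentagonal t \<longleftrightarrow> t = s \<and> d = 0"
      using pentagonal_block_unique[of s d t 0] assms by (auto simp: n_def)
    moreover have "n = pentagonal t + t \<longleftrightarrow> t = s \<and> d = s"
      using pentagonal_block_unique[of s d t t] assms by (auto simp: n_def)
    ultimately show "fps_nth ((- 1) ^ t *
      (fps_X ^ pentagonal t + (if t = 0 then 0 else fps_X ^ (pentagonal t + t)))) n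
      = (if t = s then (if d = 0 \<or> d = s then (- 1) ^ s else 0) else (0::int))"
      \<comment> \<open>For \<open>s = 0\<close> the two pentagonal numbers coincide, and the inner
        \<open>if\<close> keeps the constant term from being counted twice.\<close>
      unfolding sign by (cases "s = 0") (auto simp: fps_X_power_nth)
  qed simp
  also have "\<dots> = (if d = 0 \<or> d = s then (- 1) ^ s else 0)"
    using \<open>s \<le> n\<close> by (simp add: sum.delta)
  finally show ?thesis by (simp add: n_def)
qed

lemma euler_nth_range: "fps_nth euler n \<in> {- 1, 0, 1}"
proof -
  obtain s d where "n = pentagonal s + d" "d \<le> 3 * s" by (rule pentagonal_blocks)
  then show ?thesis by (cases "even s") (auto simp: euler_nth)
qed

text \<open>Neighbouring exponents differ by t within block t and by 2v + 1 from block v to block v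
  + 1. Only the larger exponent has to lie beyond \<open>pentagonal S\<close>.\<close>

lemma euler_gap:
  assumes "fps_nth euler x \<noteq> 0" "fps_nth euler y \<noteq> 0" "x < y" "pentagonal S \<le> y"
  shows "x + S \<le> y"
proof -
  obtain u c where x: "x = pentagonal u + c" "c \<le> 3 * u" by (rule pentagonal_blocks)
  obtain t d where y: "y = pentagonal t + d" "d \<le> 3 * t" by (rule pentagonal_blocks)
  have c: "c = 0 \<or> c = u" and d: "d = 0 \<or> d = t"
    using assms x y by (auto simp: euler_nth split: if_splits)
  have "S \<le> t" using pentagonal_strict_mono[of t S] assms y by (cases "S \<le> t") auto
  have "u \<le> t" using pentagonal_strict_mono[of t u] assms x y by (cases "u \<le> t") auto
  show ?thesis
  proof (cases "u = t")
    case True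
    then show ?thesis using x y c d \<open>x < y\<close> \<open>S \<le> t\<close> by auto
  next
    case False
    with \<open>u \<le> t\<close> obtain v where v: "t = Suc v" "u \<le> v" by (cases t) auto
    have "pentagonal u + u \<le> pentagonal v + v"
      using pentagonal_strict_mono[of u v] v by (cases "u = v") auto
    then show ?thesis using x y c v \<open>S \<le> t\<close> by auto
  qed
qed

section \<open>Partial sums: the coefficients of (q;q)_\<infinity> / (1 - q)\<close>

definition euler_psum :: "nat \<Rightarrow> int" where
  "euler_psum n = (\<Sum>i\<le>n. fps_nth euler i)"

text \<open>For \<open>s > 0\<close> the previous block leaves the sum (-1)^(s-1). The first of the
  two equal signs in block s cancels it, the second makes the sum (-1)^s.\<close>

lemma euler_psum_block:
  assumes "d \<le> 3 * s"
  shows "euler_psum (pentagonal s + d) = (if s \<le> d then (- 1) ^ s else 0)"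
  using assms
proof (induction n \<equiv> "pentagonal s + d" arbitrary: s d)
  case 0
  then have "s = 0" "d = 0" using pentagonal_ge[of s] by auto
  then show ?case using euler_nth[of 0 0] by (simp add: euler_psum_def)
next
  case (Suc n)
  have sum: "euler_psum (pentagonal s + d) = euler_psum n + fps_nth euler (pentagonal s + d)"
    unfolding Suc.hyps(2)[symmetric] euler_psum_def by simp
  show ?case
  proof (cases d)
    case 0
    then obtain t where t: "s = Suc t" using Suc.hyps(2) by (cases s) auto
    have "euler_psum (pentagonal t + 3 * t) = (- 1) ^ t"
      using Suc.hyps(1)[of t "3 * t"] Suc.hyps(2) t 0 by simp
    moreover have "n = pentagonal t + 3 * t" using Suc.hyps(2) t 0 by simp
    ultimately show ?thesis unfolding sum using euler_nth[of 0 s] 0 t by simp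
  next
    case (Suc c)
    with Suc.hyps have n: "n = pentagonal s + c" by simp
    show ?thesis unfolding sum euler_nth[OF Suc.prems]
      using Suc.hyps(1)[OF n] Suc.prems Suc n by auto
  qed
qed

lemma euler_psum_range: "euler_psum n \<in> {- 1, 0, 1}"
proof -
  obtain s d where "n = pentagonal s + d" "d \<le> 3 * s" by (rule pentagonal_blocks)
  then show ?thesis by (cases "even s") (auto simp: euler_psum_block)
qed

section \<open>Reduction to products of Pochhammer symbols\<close>

text \<open>Telescopes, since
  \<open>fps_X ^ Suc j * qpoch j = qpoch j - qpoch (Suc j)\<close>.\<close>

lemma sum_X_qpoch: "(\<Sum>j<N. fps_X ^ Suc j * qpoch j) = 1 - (qpoch N :: int fps)"
proof (induction N)
  case (Suc N)
  then show ?case by (simp add: qpoch_Suc algebra_simps)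
qed simp

lemma F_series_1_nth: "fps_nth (F_series 1 :: int fps) n = - fps_nth euler (Suc n)"
proof -
  have "fps_nth (F_series 1 :: int fps) n = fps_nth (\<Sum>j\<le>n. fps_X ^ j * qpoch j) n"
    by (simp add: fps_nth_F_series fps_sum_nth)
  also have "\<dots> = fps_nth (fps_X * (\<Sum>j\<le>n. fps_X ^ j * qpoch j)) (Suc n)" by simp
  also have "fps_X * (\<Sum>j\<le>n. fps_X ^ j * qpoch j :: int fps) = 1 - qpoch (Suc n)"
    unfolding sum_X_qpoch[symmetric] lessThan_Suc_atMost by (simp add: sum_distrib_left mult_ac)
  also have "fps_nth \<dots> (Suc n) = - fps_nth euler (Suc n)" by (simp add: qpoch_nth_stable)
  finally show ?thesis .
qed

text \<open>The j-th summands combine to a telescoping difference: (1 - q^k) q^(kj) (q;q)_j +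
  q^((k+1)(j+1)) (q;q)_j = q^(kj) (q;q)_j - q^(k(j+1)) (q;q)_(j+1). Truncated at j = n, the
  remainder starts beyond q^n.\<close>

lemma F_series_functional_equation:
  assumes "k \<ge> 1"
  shows "fps_X ^ Suc k * F_series (Suc k) = 1 - (1 - fps_X ^ k) * (F_series k :: int fps)"
proof (rule fps_ext)
  fix n
  define P where "P k m = (\<Sum>j\<le>m. fps_X ^ (k * j) * qpoch j :: int fps)" for k m
  have P_nth: "fps_nth (P k m) i = fps_nth (F_series k) i" if "k \<ge> 1" "i \<le> m" for k m i
  proof -
    have "fps_nth (P k m) i = (\<Sum>j\<le>m. fps_nth (fps_X ^ (k * j) * qpoch j :: int fps) i)"
      by (simp add: P_def fps_sum_nth)
    also have "\<dots> = (\<Sum>j\<le>i. fps_nth (fps_X ^ (k * j) * qpoch j :: int fps) i)"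
    proof (rule sum.mono_neutral_right)
      show "\<forall>j\<in>{..m} - {..i}. fps_nth (fps_X ^ (k * j) * qpoch j :: int fps) i = 0"
      proof
        fix j assume "j \<in> {..m} - {..i}"
        then have "i < j" by simp
        also have "j \<le> k * j" using \<open>k \<ge> 1\<close> by simp
        finally show "fps_nth (fps_X ^ (k * j) * qpoch j :: int fps) i = 0"
          by (simp add: fps_X_power_mult_nth)
      qed
    qed (use that in auto)
    finally show ?thesis using that by (simp add: fps_nth_F_series)
  qed
  have "(1 - fps_X ^ k) * P k m + fps_X ^ Suc k * P (Suc k) m
      = 1 - fps_X ^ (k * Suc m) * qpoch (Suc m)" for m
    by (induction m) (simp_all add: P_def qpoch_Suc algebra_simps power_add)
  from arg_cong[OF this[of n], of "\<lambda>f. fps_nth f n"]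
  have "fps_nth ((1 - fps_X ^ k) * P k n) n + fps_nth (fps_X ^ Suc k * P (Suc k) n) n
      = fps_nth 1 n - fps_nth (fps_X ^ (k * Suc n) * qpoch (Suc n)) n"
    by (simp only: fps_add_nth fps_sub_nth)
  moreover have "n < k * Suc n" using assms by (cases k) auto
  then have "fps_nth (fps_X ^ (k * Suc n) * qpoch (Suc n) :: int fps) n = 0"
    by (simp only: fps_X_power_mult_nth if_True)
  moreover have "fps_nth ((1 - fps_X ^ k) * P k n) n = fps_nth ((1 - fps_X ^ k) * F_series k) n"
    using assms by (simp add: mult.commute[of "1 - fps_X ^ k"] nth_mult_one_minus_X_power P_nth)
  moreover have "fps_nth (fps_X ^ Suc k * P (Suc k) n) n
      = fps_nth (fps_X ^ Suc k * F_series (Suc k) :: int fps) n"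
    by (simp add: fps_X_power_mult_nth P_nth del: power_Suc)
  ultimately show "fps_nth (fps_X ^ Suc k * F_series (Suc k)) n
      = fps_nth (1 - (1 - fps_X ^ k) * (F_series k :: int fps)) n"
    by simp
qed

lemma F_series_Suc_nth:
  assumes "k \<ge> 1"
  shows "fps_nth (F_series (Suc k) :: int fps) n
    = fps_nth (F_series k) (Suc n) - fps_nth (F_series k) (n + Suc k)"
proof -
  have "fps_nth (F_series (Suc k) :: int fps) n
      = fps_nth (fps_X ^ Suc k * F_series (Suc k) :: int fps) (n + Suc k)"
    by (simp add: fps_X_power_mult_nth del: power_Suc)
  also have "\<dots> = - fps_nth (F_series k * (1 - fps_X ^ k)) (n + Suc k)"
    unfolding F_series_functional_equation[OF assms]
    by (simp add: mult.commute[of "F_series k"])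
  finally show ?thesis by (simp add: nth_mult_one_minus_X_power)
qed

text \<open>Each step of the recurrence multiplies by -(1 - q^k), which extends (q;q)_(k-1) to
  (q;q)_k, and shifts the index by k + 1. With the shift by 1 for F_1, the shifts add up to a
  triangular number.\<close>

lemma F_series_nth:
  assumes "k \<ge> 1"
  shows "fps_nth (F_series k :: int fps) n
    = (- 1) ^ k * fps_nth (qpoch (k - 1) * euler) (n + k * (k + 1) div 2)"
  using assms
proof (induction k arbitrary: n rule: dec_induct)
  case base
  then show ?case using F_series_1_nth by simp
next
  case (step k)
  have "qpoch k = qpoch (k - 1) * (1 - fps_X ^ k :: int fps)"
    using step.hyps qpoch_Suc[of "k - 1"] by simp
  then have q: "qpoch (Suc k - 1) * euler = qpoch (k - 1) * euler * (1 - fps_X ^ k)"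
    by (simp add: mult_ac)
  have t: "Suc k * (Suc k + 1) div 2 = k * (k + 1) div 2 + Suc k" by simp
  show ?case
    unfolding F_series_Suc_nth[OF step.hyps(1)] step.IH q nth_mult_one_minus_X_power t
    by (simp add: algebra_simps)
qed

text \<open>The coefficient arguments run over the integers; this lemma and
  \<open>F_series_nth_of_int\<close> carry them over to the complex series.\<close>

lemma qpoch_nth_of_int:
  "fps_nth (qpoch m :: 'a::comm_ring_1 fps) n = of_int (fps_nth (qpoch m) n)"
proof (induction m arbitrary: n)
  case (Suc m)
  then show ?case by (simp add: qpoch_Suc nth_mult_one_minus_X_power del: power_Suc)
qed (simp add: fps_one_nth)

lemma F_series_nth_of_int:
  assumes "k \<ge> 1"
  shows "fps_nth (F_series k :: 'a::comm_ring_1 fps) n = of_int (fps_nth (F_series k) n)"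
  unfolding fps_nth_F_series[OF assms] of_int_sum
  by (intro sum.cong) (simp_all add: fps_X_power_mult_nth qpoch_nth_of_int[where 'a = 'a])

section \<open>Far coefficients: isolated copies of (q;q)_m\<close>

lemma qpoch_euler_nth:
  "fps_nth (qpoch m * euler) n = (\<Sum>i\<le>n. fps_nth (qpoch m) i * fps_nth euler (n - i))"
  by (simp add: fps_mult_nth atMost_atLeast0)

text \<open>Two nonzero terms of the convolution would need two exponents of \<open>euler\<close>
  whose distance is at most the degree m(m+1)/2, the larger one being at least
  \<open>pentagonal S\<close>. The gap there is at least \<open>S\<close>, which exceeds the
  degree.\<close>

lemma qpoch_euler_nth_eventually:
  assumes "m * (m + 1) div 2 < S" "pentagonal S + m * (m + 1) div 2 \<le> n"
  obtains "fps_nth (qpoch m * euler) n = 0"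
  | i where "fps_nth (qpoch m * euler) n = fps_nth (qpoch m) i * fps_nth euler (n - i)"
proof -
  define D where "D = m * (m + 1) div 2"
  define t where "t i = fps_nth (qpoch m) i * fps_nth euler (n - i)" for i
  have unique: "i = j" if "t i \<noteq> 0" "t j \<noteq> 0" for i j
  proof -
    have *: False if "t i \<noteq> 0" "t j \<noteq> 0" "i < j" for i j
    proof -
      have "i \<le> D" "j \<le> D"
        unfolding D_def by (rule qpoch_nth_degree, use that in \<open>simp add: t_def\<close>)+
      then have "n - j + S \<le> n - i"
        using that assms by (intro euler_gap) (auto simp: t_def D_def)
      then show False using \<open>i \<le> D\<close> \<open>j \<le> D\<close> assms by (simp add: D_def)
    qed
    show ?thesis using *[OF that] *[OF that(2,1)] by (cases i j rule: linorder_cases) auto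
  qed
  show ?thesis
  proof (cases "\<exists>i\<le>n. t i \<noteq> 0")
    case True
    then obtain i where i: "i \<le> n" "t i \<noteq> 0" by auto
    have "(\<Sum>j\<le>n. t j) = (\<Sum>j\<in>{i}. t j)"
      using i unique by (intro sum.mono_neutral_right) auto
    then show ?thesis using that(2)[of i] by (simp add: qpoch_euler_nth t_def)
  next
    case False
    then have "(\<Sum>j\<le>n. t j) = 0" by (intro sum.neutral) auto
    then show ?thesis using that(1) by (simp add: qpoch_euler_nth t_def)
  qed
qed

text \<open>The term \<open>j = i\<close> meets the exponent \<open>pentagonal S\<close>. Another
  nonzero term would meet an exponent less than \<open>S\<close> away from it, which the gaps on
  both sides exclude.\<close>

lemma qpoch_euler_nth_at_pentagonal:
  assumes "m * (m + 1) div 2 < S" "fps_nth (qpoch m) i \<noteq> (0::int)"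
  shows "fps_nth (qpoch m * euler) (pentagonal S + i) = (- 1) ^ S * fps_nth (qpoch m) i"
proof -
  define D where "D = m * (m + 1) div 2"
  let ?n = "pentagonal S + i"
  have euler_S: "fps_nth euler (pentagonal S) = (- 1) ^ S"
    using euler_nth[of 0 S] by simp
  have "i \<le> D" unfolding D_def by (rule qpoch_nth_degree) (fact assms)
  have "(\<Sum>j\<le>?n. fps_nth (qpoch m) j * fps_nth euler (?n - j))
      = (\<Sum>j\<in>{i}. fps_nth (qpoch m) j * fps_nth euler (?n - j))"
  proof (rule sum.mono_neutral_right)
    show "\<forall>j\<in>{..?n} - {i}. fps_nth (qpoch m) j * fps_nth euler (?n - j) = 0"
    proof (intro ballI, rule ccontr)
      fix j
      assume j: "j \<in> {..?n} - {i}"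
        and nz: "fps_nth (qpoch m) j * fps_nth euler (?n - j) \<noteq> 0"
      have "j \<le> D" unfolding D_def by (rule qpoch_nth_degree) (use nz in simp)
      consider "i < j" | "j < i" using j by (cases i j rule: linorder_cases) auto
      then show False
      proof cases
        case 1
        then have "?n - j + S \<le> pentagonal S"
          using nz j euler_S by (intro euler_gap) auto
        then show False using \<open>j \<le> D\<close> assms 1 by (simp add: D_def)
      next
        case 2
        then have "pentagonal S + S \<le> ?n - j"
          using nz j euler_S by (intro euler_gap) auto
        then show False using \<open>i \<le> D\<close> assms 2 by (simp add: D_def)
      qed
    qed
  qed auto
  then show ?thesis unfolding qpoch_euler_nth by (simp add: euler_S)
qed

section \<open>Large coefficients of finite Pochhammer symbols\<close>

text \<open>The coefficients of (q;q)_\<infinity> / ((1 - q)(1 - q^2)): division by 1 - q^2 adds up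
  every second partial sum.\<close>

definition euler_psum2 :: "nat \<Rightarrow> int" where
  "euler_psum2 n = (\<Sum>j\<le>n div 2. euler_psum (n - 2 * j))"

definition euler_psum_fps :: "int fps" where "euler_psum_fps = Abs_fps euler_psum"
definition euler_psum2_fps :: "int fps" where "euler_psum2_fps = Abs_fps euler_psum2"

lemma euler_psum_fps_eq: "(1 - fps_X) * euler_psum_fps = euler"
proof (rule fps_ext)
  fix n
  show "fps_nth ((1 - fps_X) * euler_psum_fps) n = fps_nth euler n"
    by (cases n) (simp_all add: euler_psum_fps_def euler_psum_def algebra_simps)
qed

lemma euler_psum2_rec: "euler_psum2 (Suc (Suc n)) = euler_psum (Suc (Suc n)) + euler_psum2 n"
  by (simp add: euler_psum2_def sum.atMost_Suc_shift del: sum.atMost_Suc)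

lemma euler_psum2_fps_eq: "(1 - fps_X ^ 2) * euler_psum2_fps = euler_psum_fps"
proof (rule fps_ext)
  fix n
  have "fps_nth ((1 - fps_X ^ 2) * euler_psum2_fps) n
      = euler_psum2 n - (if n < 2 then 0 else euler_psum2 (n - 2))"
    by (simp add: mult.commute[of "1 - fps_X ^ 2"] nth_mult_one_minus_X_power euler_psum2_fps_def)
  also have "\<dots> = euler_psum n"
  proof (cases "n < 2")
    case True
    then show ?thesis by (simp add: euler_psum2_def)
  next
    case False
    then obtain m where "n = Suc (Suc m)"
      by (metis add_2_eq_Suc le_add_diff_inverse not_less)
    then show ?thesis by (simp add: euler_psum2_rec)
  qed
  finally show "fps_nth ((1 - fps_X ^ 2) * euler_psum2_fps) n = fps_nth euler_psum_fps n"
    by (simp add: euler_psum_fps_def)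
qed

text \<open>The product of \<open>(q;q)_\<infinity>\<close> with the expansion of \<open>1 / (q^M;q)_\<infinity>\<close> modulo \<open>q^(3M)\<close>.\<close>

definition qpoch_approx :: "nat \<Rightarrow> int fps" where
  "qpoch_approx M = euler + fps_X ^ M * euler_psum_fps + fps_X ^ (2 * M) * euler_psum2_fps"

text \<open>In powers of y = q^M, the linear and quadratic terms match by
  \<open>euler_psum_fps_eq\<close> and \<open>euler_psum2_fps_eq\<close>; only the cubic term is
  left over.\<close>

lemma qpoch_approx_step:
  "qpoch_approx M * (1 - fps_X ^ M) = qpoch_approx (Suc M) - fps_X ^ (3 * M) * euler_psum2_fps"
proof -
  have "2 * M = M + M" "3 * M = M + M + M" "2 * Suc M = 2 + M + M" by simp_all
  then have e: "X ^ (2 * M) = X ^ M * X ^ M" "X ^ (3 * M) = X ^ M * X ^ M * X ^ M"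
    "X ^ Suc M = X * X ^ M" "X ^ (2 * Suc M) = X ^ 2 * X ^ M * X ^ M" for X :: "int fps"
    by (simp_all only: power_add power_Suc)
  show ?thesis
    unfolding qpoch_approx_def e[of fps_X]
      euler_psum_fps_eq[symmetric] euler_psum2_fps_eq[symmetric] by algebra
qed

text \<open>The product rule is read backwards: it expresses a coefficient of (q;q)_m by one of
  (q;q)_(m+1) and a lower one of (q;q)_m, both with smaller \<open>n - m\<close>. The descent ends
  at \<open>n \<le> m\<close>, where both sides are coefficients of \<open>euler\<close>.\<close>

lemma qpoch_nth_approx:
  assumes "n < 3 * Suc m"
  shows "fps_nth (qpoch m) n = fps_nth (qpoch_approx (Suc m)) n"
  using assms
proof (induction "n - m" arbitrary: n m rule: less_induct)
  case less
  show ?case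
  proof (cases "n \<le> m")
    case True
    then show ?thesis
      by (simp add: qpoch_nth_stable qpoch_approx_def fps_X_power_mult_nth del: power_Suc)
  next
    case False
    have 1: "fps_nth (qpoch (Suc m)) n = fps_nth (qpoch_approx (Suc (Suc m))) n"
      using less False by (intro less.hyps) auto
    have 2: "fps_nth (qpoch m) (n - Suc m) = fps_nth (qpoch_approx (Suc m)) (n - Suc m)"
      using less False by (intro less.hyps) auto
    have "fps_nth (qpoch_approx (Suc m) * (1 - fps_X ^ Suc m)) n
        = fps_nth (qpoch_approx (Suc (Suc m))) n"
      unfolding qpoch_approx_step using less.prems
      by (simp add: fps_X_power_mult_nth del: power_Suc mult_Suc_right)
    then show ?thesis using 1 2 False by (simp add: qpoch_Suc nth_mult_one_minus_X_power del: power_Suc)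
  qed
qed

lemma qpoch_nth_middle:
  assumes "r < M"
  shows "fps_nth (qpoch (M - 1)) (2 * M + r)
    = fps_nth euler (2 * M + r) + euler_psum (M + r) + euler_psum2 r"
proof -
  have "Suc (M - 1) = M" using assms by simp
  with qpoch_nth_approx[of "2 * M + r" "M - 1"] assms
  have "fps_nth (qpoch (M - 1)) (2 * M + r) = fps_nth (qpoch_approx M) (2 * M + r)" by simp
  then show ?thesis
    by (simp add: qpoch_approx_def fps_X_power_mult_nth euler_psum_fps_def euler_psum2_fps_def
        add.commute)
qed

section \<open>Executable coefficient tables\<close>

fun blocks :: "(nat \<Rightarrow> nat \<Rightarrow> int) \<Rightarrow> nat \<Rightarrow> int list" where
  "blocks f 0 = []"
| "blocks f (Suc s) = blocks f s @ map (f s) [0..<3 * s + 1]"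

lemma length_blocks [simp]: "length (blocks f S) = pentagonal S"
  by (induction S) simp_all

lemma nth_blocks:
  assumes "\<And>s d. d \<le> 3 * s \<Longrightarrow> g (pentagonal s + d) = f s d" "n < pentagonal S"
  shows "blocks f S ! n = g n"
  using assms(2)
proof (induction S)
  case (Suc S)
  then show ?case using assms(1)[of "n - pentagonal S" S]
    by (cases "n < pentagonal S") (simp_all add: nth_append del: upt_Suc)
qed simp

definition euler_list :: "nat \<Rightarrow> int list" where
  "euler_list = blocks (\<lambda>s d. if d = 0 \<or> d = s then (- 1) ^ s else 0)"
definition euler_psum_list :: "nat \<Rightarrow> int list" where
  "euler_psum_list = blocks (\<lambda>s d. if s \<le> d then (- 1) ^ s else 0)"

lemma nth_euler_list: "n < pentagonal S \<Longrightarrow> euler_list S ! n = fps_nth euler n"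
  unfolding euler_list_def by (rule nth_blocks[where g = "fps_nth euler"]) (simp_all add: euler_nth)

lemma nth_euler_psum_list: "n < pentagonal S \<Longrightarrow> euler_psum_list S ! n = euler_psum n"
  unfolding euler_psum_list_def
  by (rule nth_blocks[where g = euler_psum]) (simp_all add: euler_psum_block)

text \<open>Division by 1 - q^2 in one pass; \<open>a\<close> and \<open>b\<close> are the results
  two places and one place back.\<close>

fun skip_sums :: "int \<Rightarrow> int \<Rightarrow> int list \<Rightarrow> int list" where
  "skip_sums a b [] = []"
| "skip_sums a b (x # xs) = (x + a) # skip_sums b (x + a) xs"

lemma length_skip_sums [simp]: "length (skip_sums a b xs) = length xs"
  by (induction xs arbitrary: a b) simp_all

lemma nth_skip_sums:
  assumes "\<And>n. n < length xs \<Longrightarrow> f (Suc (Suc n)) = xs ! n + f n" "n < length xs"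
  shows "skip_sums (f 0) (f (Suc 0)) xs ! n = f (Suc (Suc n))"
  using assms
proof (induction xs arbitrary: f n)
  case (Cons x xs)
  have f2: "f (Suc (Suc 0)) = x + f 0" using Cons.prems(1)[of 0] by simp
  show ?case
  proof (cases n)
    case 0
    then show ?thesis using f2 by simp
  next
    case (Suc m)
    have "skip_sums (f (Suc 0)) (f (Suc (Suc 0))) xs ! m = f (Suc (Suc (Suc m)))"
    proof (rule Cons.IH[of "\<lambda>n. f (Suc n)"])
      show "f (Suc (Suc (Suc i))) = xs ! i + f (Suc i)" if "i < length xs" for i
        using Cons.prems(1)[of "Suc i"] that by simp
    qed (use Cons.prems Suc in simp)
    then show ?thesis using f2 Suc by simp
  qed
qed simp

lemma nth_euler_psum2_list:
  assumes "n < pentagonal S"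
  shows "skip_sums 0 0 (euler_psum_list S) ! n = euler_psum2 n"
proof -
  \<comment> \<open>The shift by two turns the initial values 0, 0 of \<open>skip_sums\<close> into
    \<open>f 0\<close> and \<open>f 1\<close>.\<close>
  define f where "f n = (if n < 2 then 0 else euler_psum2 (n - 2))" for n
  have "length (euler_psum_list S) = pentagonal S" by (simp add: euler_psum_list_def)
  moreover have "euler_psum2 n = euler_psum n + f n" for n
  proof (cases "n < 2")
    case True
    then show ?thesis by (simp add: f_def euler_psum2_def)
  next
    case False
    then obtain m where "n = Suc (Suc m)"
      by (metis add_2_eq_Suc le_add_diff_inverse not_less)
    then show ?thesis by (simp add: f_def euler_psum2_rec)
  qed
  then have "f (Suc (Suc n)) = euler_psum n + f n" for n by (simp add: f_def)
  ultimately have "skip_sums (f 0) (f (Suc 0)) (euler_psum_list S) ! n = f (Suc (Suc n))"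
    using assms by (intro nth_skip_sums) (simp_all add: nth_euler_psum_list)
  then show ?thesis by (simp add: f_def)
qed

text \<open>Position r of the zipped lists holds the three summands of
  \<open>qpoch_nth_middle\<close>; \<open>take M\<close> enforces its condition r < M.\<close>

definition qpoch_middle_check :: "int list \<Rightarrow> int list \<Rightarrow> int list \<Rightarrow> nat list \<Rightarrow> bool" where
  "qpoch_middle_check es ps ss Ms \<longleftrightarrow> list_all (\<lambda>M. list_ex (\<lambda>(e, p, s). \<bar>e + p + s\<bar> > 1)
    (take M (zip (drop (2 * M) es) (zip (drop M ps) ss)))) Ms"

text \<open>The table sizes suffice: for \<open>M < 70\<close> the largest index 3M - 1 is at most
  206, below \<open>pentagonal 12 = 210\<close>, and r stays below
  \<open>pentagonal 7 = 70\<close>.\<close>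

lemma qpoch_middle_check_upto:
  "qpoch_middle_check (euler_list 12) (euler_psum_list 12)
    (skip_sums 0 0 (euler_psum_list 7)) [7..<70]"
  by code_simp

lemma pentagonal_values: "pentagonal 7 = 70" "pentagonal 12 = 210"
  by code_simp+

lemma qpoch_large_coeff:
  assumes "M \<ge> 7"
  obtains i where "\<bar>fps_nth (qpoch (M - 1) :: int fps) i\<bar> > 1"
proof (cases "M < 70")
  case True
  let ?es = "euler_list 12" and ?ps = "euler_psum_list 12" and ?ss = "skip_sums 0 0 (euler_psum_list 7)"
  have len: "length ?es = 210" "length ?ps = 210" "length ?ss = 70"
    by (simp_all add: euler_list_def euler_psum_list_def pentagonal_values del: pentagonal.simps)
  have "list_ex (\<lambda>(e, p, s). \<bar>e + p + s\<bar> > 1)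
      (take M (zip (drop (2 * M) ?es) (zip (drop M ?ps) ?ss)))"
    using qpoch_middle_check_upto unfolding qpoch_middle_check_def list_all_iff
    by (rule bspec) (use True assms in \<open>simp only: set_upt atLeastLessThan_iff\<close>)
  then obtain r where r: "r < M" and "\<bar>?es ! (2 * M + r) + (?ps ! (M + r) + ?ss ! r)\<bar> > 1"
    unfolding list_ex_length using len by (auto simp: add.assoc)
  moreover have "?es ! (2 * M + r) = fps_nth euler (2 * M + r)"
    using r True by (intro nth_euler_list) (simp add: pentagonal_values del: pentagonal.simps)
  moreover have "?ps ! (M + r) = euler_psum (M + r)"
    using r True by (intro nth_euler_psum_list) (simp add: pentagonal_values del: pentagonal.simps)
  moreover have "?ss ! r = euler_psum2 r"
    using r True by (intro nth_euler_psum2_list) (simp add: pentagonal_values del: pentagonal.simps)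
  ultimately have "\<bar>fps_nth (qpoch (M - 1)) (2 * M + r)\<bar> > (1::int)"
    by (simp only: qpoch_nth_middle add.assoc)
  then show ?thesis by (rule that)
next
  case False
  \<comment> \<open>The index 69 is admissible because \<open>M \<ge> 70\<close>; the other two
    summands can lower the value 4 to 2 at worst.\<close>
  have "skip_sums 0 0 (euler_psum_list 7) ! 69 = 4" by code_simp
  then have "euler_psum2 69 = 4" using nth_euler_psum2_list[of 69 7]
    by (simp add: pentagonal_values del: pentagonal.simps)
  moreover have "fps_nth (qpoch (M - 1)) (2 * M + 69)
      = fps_nth euler (2 * M + 69) + euler_psum (M + 69) + euler_psum2 69"
    using False by (intro qpoch_nth_middle) simp
  ultimately have "\<bar>fps_nth (qpoch (M - 1)) (2 * M + 69)\<bar> > (1::int)"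
    using euler_nth_range[of "2 * M + 69"] euler_psum_range[of "M + 69"] by auto
  then show ?thesis by (rule that)
qed

section \<open>The Bloch--Polya property\<close>

lemma bloch_polya_of_int:
  assumes "\<And>n. fps_nth f n = of_int (g n)"
  shows "bloch_polya (f :: complex fps) \<longleftrightarrow> (\<forall>n. \<bar>g n\<bar> \<le> 1)"
proof -
  have "(of_int c \<in> {- 1, 0, 1 :: complex}) = (\<bar>c\<bar> \<le> 1)" for c
  proof -
    have "(of_int c \<in> {- 1, 0, 1 :: complex}) \<longleftrightarrow> c \<in> {- 1, 0, 1}"
      using of_int_eq_iff[of c "- 1", where 'a = complex] by simp
    then show ?thesis by auto
  qed
  then show ?thesis by (simp only: bloch_polya_def assms)
qed

text \<open>Copies of (q;q)_(k-1) recur, up to sign, beyond the degree of any \<open>f\<close>, so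
  no polynomial can repair a coefficient that is too large.\<close>

lemma not_bloch_polya_add_poly:
  assumes "k \<ge> 1" "\<bar>fps_nth (qpoch (k - 1) :: int fps) i\<bar> > 1"
  shows "\<not> bloch_polya (F_series k + fps_of_poly f :: complex fps)"
proof
  assume bp: "bloch_polya (F_series k + fps_of_poly f :: complex fps)"
  define T where "T = k * (k + 1) div 2"
  \<comment> \<open>Exceeds the degree of (q;q)_(k-1), so that the copy is isolated, and is large
    enough that \<open>n\<close> lies beyond the degree of \<open>f\<close> after the shift by
    \<open>T\<close>.\<close>
  define S where "S = Suc ((k - 1) * (k - 1 + 1) div 2 + degree f + T)"
  define n where "n = pentagonal S + i - T"
  have n: "n + T = pentagonal S + i" "degree f < n"
    using pentagonal_ge[of S] by (simp_all add: n_def S_def)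
  have "fps_nth (F_series k :: int fps) n
      = (- 1) ^ k * fps_nth (qpoch (k - 1) * euler) (pentagonal S + i)"
    using F_series_nth[OF assms(1), of n] n by (simp add: T_def)
  also have "fps_nth (qpoch (k - 1) * euler) (pentagonal S + i) = (- 1) ^ S * fps_nth (qpoch (k - 1)) i"
    using assms(2) by (intro qpoch_euler_nth_at_pentagonal) (auto simp: S_def)
  finally have "\<bar>fps_nth (F_series k :: int fps) n\<bar> > 1"
    using assms(2) by (simp add: abs_mult power_abs)
  moreover have "coeff f n = 0" using n by (simp add: coeff_eq_0)
  then have "fps_nth (F_series k + fps_of_poly f :: complex fps) n
      = of_int (fps_nth (F_series k) n)"
    using F_series_nth_of_int[OF assms(1), where 'a = complex] by simp
  then have "of_int (fps_nth (F_series k) n) \<in> {- 1, 0, 1 :: complex}"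
    using bp unfolding bloch_polya_def by metis
  then have "fps_nth (F_series k) n \<in> {- 1, 0, 1 :: int}"
    using of_int_eq_iff[of _ "- 1", where 'a = complex] by simp
  ultimately show False by auto
qed

section \<open>Finite check for the positive statements\<close>

fun sparse_nth :: "(int \<times> nat) list \<Rightarrow> nat \<Rightarrow> int" where
  "sparse_nth [] n = 0"
| "sparse_nth ((c, e) # xs) n = (if n = e then c else 0) + sparse_nth xs n"

text \<open>An exponent past the end of the list is harmless, as the list update then changes
  nothing.\<close>

fun sparse_sub :: "(int \<times> nat) list \<Rightarrow> int list \<Rightarrow> int list" where
  "sparse_sub [] ys = ys"
| "sparse_sub ((c, e) # xs) ys = sparse_sub xs (ys[e := ys ! e - c])"

lemma length_sparse_sub [simp]: "length (sparse_sub xs ys) = length ys"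
  by (induction xs ys rule: sparse_sub.induct) simp_all

lemma nth_sparse_sub: "n < length ys \<Longrightarrow> sparse_sub xs ys ! n = ys ! n - sparse_nth xs n"
  by (induction xs ys rule: sparse_sub.induct) (auto simp: nth_list_update)

lemma sparse_nth_beyond: "\<forall>(c, e) \<in> set xs. e < n \<Longrightarrow> sparse_nth xs n = 0"
  by (induction xs) auto

text \<open>Multiplication by 1 - q^(m+1) subtracts a shifted copy; \<open>map2\<close> cuts the
  padded copy back to the length of the table.\<close>

fun qpoch_euler_list :: "nat \<Rightarrow> nat \<Rightarrow> int list" where
  "qpoch_euler_list S 0 = euler_list S"
| "qpoch_euler_list S (Suc m) =
    (let xs = qpoch_euler_list S m in map2 (-) xs (replicate (Suc m) 0 @ xs))"

lemma length_qpoch_euler_list [simp]: "length (qpoch_euler_list S m) = pentagonal S"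
  by (induction m) (simp_all add: Let_def euler_list_def)

lemma nth_qpoch_euler_list:
  "n < pentagonal S \<Longrightarrow> qpoch_euler_list S m ! n = fps_nth (qpoch m * euler) n"
proof (induction m arbitrary: n)
  case (Suc m)
  have q: "qpoch (Suc m) * euler = qpoch m * euler * (1 - fps_X ^ Suc m)"
    by (simp add: qpoch_Suc mult_ac)
  show ?case
    using Suc unfolding q nth_mult_one_minus_X_power
    by (simp add: Let_def nth_append del: replicate_Suc)
qed (simp add: nth_euler_list)

text \<open>The tested coefficient list ends with a full copy of \<open>(q;q)_(k-1)\<close>, starting at
  \<open>pentagonal (k * (k - 1) div 2 + 1)\<close> and not affected by the correction terms. So the check also
  bounds the coefficients of \<open>(q;q)_(k-1)\<close>, and thereby all further coefficients.\<close>

definition bp_check :: "nat \<Rightarrow> (int \<times> nat) list \<Rightarrow> bool" where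
  "bp_check k xs \<longleftrightarrow>
    list_all (\<lambda>x. \<bar>x\<bar> \<le> 1) (sparse_sub (map (\<lambda>(c, e). (c * (- 1) ^ k, e)) xs)
      (drop (k * (k + 1) div 2) (qpoch_euler_list (k * (k - 1) div 2 + 2) (k - 1)))) \<and>
    list_all (\<lambda>(c, e). e + k * (k + 1) div 2 < pentagonal (k * (k - 1) div 2 + 1)) xs"

text \<open>The lists hold the polynomial to be subtracted, hence the signs for \<open>k = 4\<close>
  are opposite to those of the added terms.\<close>

lemma bp_checks:
  "bp_check 1 []"
  "bp_check 2 []"
  "bp_check 3 [(1, 9)]"
  "bp_check 4 [(1, 16), (- 1, 18), (- 1, 30), (1, 31)]"
  by code_simp+

lemma bp_check_6:
  "bp_check 6 [(1, 29), (- 1, 32), (1, 36), (- 1, 38), (1, 43), (- 1, 45), (1, 50), (- 1, 56), (1, 57),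
    (1, 58), (- 1, 62), (- 1, 63), (1, 64), (1, 71), (- 1, 80), (- 1, 81), (1, 84), (1, 85), (1, 106),
    (- 1, 110), (- 1, 239), (1, 241), (1, 280), (- 1, 281)]"
  by code_simp

text \<open>(q;q)_4 = 1 - q - q^2 + 2q^5 - q^8 - q^9 + q^10.\<close>

lemma qpoch_4_large_coeff: "\<bar>fps_nth (qpoch 4 :: int fps) 5\<bar> > 1"
  by (simp add: numeral_eq_Suc qpoch_Suc nth_mult_one_minus_X_power del: power_Suc)

lemma bloch_polya_check:
  assumes "bp_check k xs" "k \<ge> 1" "\<And>n. fps_nth h n = of_int (sparse_nth xs n)"
  shows "bloch_polya (F_series k - h :: complex fps)"
proof -
  define T where "T = k * (k + 1) div 2"
  define D where "D = (k - 1) * (k - 1 + 1) div 2"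
  define S where "S = D + 1"
  define G where "G n = fps_nth (qpoch (k - 1) * euler) (n + T)" for n
  let ?xs = "map (\<lambda>(c, e). (c * (- 1) ^ k, e)) xs"
  let ?L = "drop T (qpoch_euler_list (Suc S) (k - 1))"
  have D: "D = k * (k - 1) div 2" using assms(2) by (simp add: D_def mult.commute)
  have *: "list_all (\<lambda>x. \<bar>x\<bar> \<le> 1) (sparse_sub ?xs ?L)"
    and small: "\<forall>(c, e) \<in> set xs. e + T < pentagonal S"
    using assms(1) by (simp_all add: bp_check_def S_def D T_def list_all_iff)
  have sparse: "sparse_nth ?xs n = (- 1) ^ k * sparse_nth xs n" for n
    by (induction xs) (auto simp: algebra_simps)
  have low: "\<bar>G n - (- 1) ^ k * sparse_nth xs n\<bar> \<le> 1" if "n + T < pentagonal (Suc S)" for n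
  proof -
    have "n < length ?L" using that by simp
    then have "\<bar>sparse_sub ?xs ?L ! n\<bar> \<le> 1" using * by (simp add: list_all_length)
    moreover have "sparse_sub ?xs ?L ! n = ?L ! n - sparse_nth ?xs n"
      using \<open>n < length ?L\<close> by (rule nth_sparse_sub)
    moreover have "?L ! n = G n"
      using that nth_qpoch_euler_list[of "n + T" "Suc S" "k - 1"]
      by (simp add: G_def add.commute del: pentagonal.simps)
    ultimately show ?thesis by (simp only: sparse)
  qed
  have high: "sparse_nth xs n = 0" if "pentagonal S \<le> n + T" for n
    using small that by (intro sparse_nth_beyond) fastforce
  \<comment> \<open>The coefficient \<open>i\<close> shows up to sign at
    \<open>pentagonal S + i\<close>. This index is inside the table, since
    \<open>i \<le> D < S\<close> and the last block has 3S + 1 entries, and no correction reaches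
    it.\<close>
  have coeff: "\<bar>fps_nth (qpoch (k - 1) :: int fps) i\<bar> \<le> 1" for i
  proof (cases "fps_nth (qpoch (k - 1) :: int fps) i = 0")
    case False
    then have "i \<le> D" unfolding D_def by (rule qpoch_nth_degree)
    have "T \<le> pentagonal S"
    proof -
      have "T = D + k"
        unfolding T_def D using assms(2) by (cases k) simp_all
      moreover have "2 * (k - 1) \<le> k * (k - 1)"
        using assms(2) by (cases "k = 1") (auto intro: mult_le_mono1)
      then have "k - 1 \<le> D" unfolding D by linarith
      moreover have "pentagonal S = pentagonal D + 3 * D + 1" by (simp add: S_def)
      ultimately show ?thesis using pentagonal_ge[of D] assms(2) by linarith
    qed
    then have "\<bar>G (pentagonal S + i - T)\<bar> \<le> 1"
      using low[of "pentagonal S + i - T"] high[of "pentagonal S + i - T"] \<open>i \<le> D\<close> by (simp add: S_def)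
    moreover have "G (pentagonal S + i - T) = (- 1) ^ S * fps_nth (qpoch (k - 1)) i"
    proof -
      have "pentagonal S + i - T + T = pentagonal S + i" using \<open>T \<le> pentagonal S\<close> by simp
      then show ?thesis unfolding G_def
        using False by (simp only:) (rule qpoch_euler_nth_at_pentagonal, simp_all add: S_def D_def)
    qed
    ultimately show ?thesis by (simp add: abs_mult power_abs)
  qed simp
  have "\<bar>G n - (- 1) ^ k * sparse_nth xs n\<bar> \<le> 1" for n
  proof (cases "n + T < pentagonal (Suc S)")
    case False
    \<comment> \<open>Past the table the index exceeds \<open>pentagonal S\<close> by more than the
      degree \<open>D\<close>, so at most one term of the convolution survives.\<close>
    then have n: "pentagonal S + D \<le> n + T" "pentagonal S \<le> n + T" by (simp_all add: S_def)
    have "\<bar>G n\<bar> \<le> 1"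
    proof (rule qpoch_euler_nth_eventually[of "k - 1" S "n + T"])
      fix i
      assume "fps_nth (qpoch (k - 1) * euler) (n + T)
        = fps_nth (qpoch (k - 1)) i * fps_nth euler (n + T - i)"
      moreover have "\<bar>fps_nth euler (n + T - i)\<bar> \<le> 1" using euler_nth_range[of "n + T - i"] by auto
      ultimately show "\<bar>G n\<bar> \<le> 1"
        using coeff[of i] by (simp add: G_def abs_mult mult_le_one)
    qed (use n in \<open>simp_all add: D_def S_def G_def\<close>)
    then show ?thesis by (simp add: high[OF n(2)])
  qed (rule low)
  moreover have "fps_nth (F_series k - h) n
      = of_int ((- 1) ^ k * (G n - (- 1) ^ k * sparse_nth xs n))" for n
    by (simp add: F_series_nth_of_int[OF assms(2), where 'a = complex] F_series_nth[OF assms(2)] assms(3)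
        G_def T_def right_diff_distrib flip: mult.assoc power_add mult_2)
  ultimately show ?thesis
    by (subst bloch_polya_of_int[where g = "\<lambda>n. (- 1) ^ k * (G n - (- 1) ^ k * sparse_nth xs n)"])
      (simp_all add: abs_mult power_abs)
qed

theorem theorem3p2:
  shows "bloch_polya (F_series 1 :: complex fps)
    \<and> bloch_polya (F_series 2 :: complex fps)
    \<and> (bloch_polya (F_series 3 - fps_X ^ 9 :: complex fps)
       \<and> bloch_polya (F_series 4 - fps_X ^ 16 + fps_X ^ 18 + fps_X ^ 30 - fps_X ^ 31 :: complex fps))
    \<and> (\<not> bloch_polya (F_series 5 :: complex fps)
       \<and> \<not> (\<exists>f :: complex poly. bloch_polya (F_series 5 + fps_of_poly f)))
    \<and> bloch_polya (F_series 6 - f6 :: complex fps)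
    \<and> (\<forall>k \<ge> 7. \<not> (\<exists>f :: complex poly. bloch_polya (F_series k + fps_of_poly f)))"
proof (intro conjI allI impI)
  show "bloch_polya (F_series 1 :: complex fps)"
    using bloch_polya_check[OF bp_checks(1), of 0] by simp
  show "bloch_polya (F_series 2 :: complex fps)"
    using bloch_polya_check[OF bp_checks(2), of 0] by simp
  show "bloch_polya (F_series 3 - fps_X ^ 9 :: complex fps)"
    by (rule bloch_polya_check[OF bp_checks(3)]) (simp_all add: fps_X_power_nth)
  have "bloch_polya (F_series 4 - (fps_X ^ 16 - fps_X ^ 18 - fps_X ^ 30 + fps_X ^ 31) :: complex fps)"
    by (rule bloch_polya_check[OF bp_checks(4)]) (simp_all add: fps_X_power_nth)
  then show "bloch_polya (F_series 4 - fps_X ^ 16 + fps_X ^ 18 + fps_X ^ 30 - fps_X ^ 31 :: complex fps)"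
    by (simp add: algebra_simps)
  have "\<not> bloch_polya (F_series 5 + fps_of_poly f :: complex fps)" for f
    using qpoch_4_large_coeff by (intro not_bloch_polya_add_poly[where i = 5]) simp_all
  from this this[of 0] show "\<not> (\<exists>f :: complex poly. bloch_polya (F_series 5 + fps_of_poly f))"
    and "\<not> bloch_polya (F_series 5 :: complex fps)" by simp_all
  show "bloch_polya (F_series 6 - f6 :: complex fps)"
    by (rule bloch_polya_check[OF bp_check_6]) (simp_all add: f6_def fps_X_power_nth)
  fix k :: nat
  assume "k \<ge> 7"
  then obtain i where "\<bar>fps_nth (qpoch (k - 1) :: int fps) i\<bar> > 1" by (rule qpoch_large_coeff)
  then show "\<not> (\<exists>f :: complex poly. bloch_polya (F_series k + fps_of_poly f))"
    using not_bloch_polya_add_poly \<open>k \<ge> 7\<close> by auto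
qed

end
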